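(* Let $n\ge 1$, let Alice's string $A$ be $\mathrm{HH}\cdots\mathrm{H}$ (length $n$, all letters $\mathrm{H}$), and let $B=B_1\cdots B_n\neq A$ be Bob's string over $\{\mathrm{H},\mathrm{T}\}$. In the No-Flippancy game with these strings: (i) Alice wins if and only if $n$ is odd and $B=\mathrm{HH}\cdots\mathrm{HT}$ (that is, $B_i=\mathrm{H}$ for $i<n$ and $B_n=\mathrm{T}$). (ii) If it is not the case that $n$ is odd and $B=\mathrm{HH}\cdots\mathrm{HT}$, then Bob wins if and only if $B$ has $\mathrm{H}$s in all odd positions or $\mathrm{H}$s in all even positions (that is, $B_i=\mathrm{H}$ for every odd $i\in\{1,\dots,n\}$, or $B_i=\mathrm{H}$ for every even $i\in\{1,\dots,n\}$). (iii) In all other cases the game is infinite.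
   Context: No-Flippancy game: Alice and Bob have distinct strings $A=A_1\cdots A_n$ and $B=B_1\cdots B_n$ of the same length $n$ over the alphabet $\{\mathrm{H},\mathrm{T}\}$. Starting from the empty sequence, the players alternate turns, Alice going first, and on each turn the current player appends one letter to the sequence (the game output) as follows: let $i<n$ be the maximal length of a suffix of the current sequence that coincides with a prefix of the current player's string ($i=0$ is allowed, via the empty suffix); the player appends the letter with index $i+1$ of their own string. The game ends as soon as $A$ or $B$ appears as a block of consecutive letters in the sequence (necessarily as its suffix, no matter who made the last move); the player whose string appears first wins. If neither string ever appears, the game is infinite. *)

theory Defs
  imports Main "HOL-Library.Sublist"
begin

datatype letter = H | T

text \<open>The largest \<open>i < length S\<close> such that the prefix of \<open>S\<close> of length \<open>i\<close> is a suffix of the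
  current sequence \<open>s\<close>.  For nonempty \<open>S\<close> the set contains \<open>0\<close>, so that \<open>Max\<close> is meaningful.\<close>

definition overlap :: "letter list \<Rightarrow> letter list \<Rightarrow> nat" where
  "overlap S s = Max {i. i < length S \<and> suffix (take i S) s}"

text \<open>List indices start at \<open>0\<close>, so the letter number \<open>i + 1\<close> of \<open>S\<close> is \<open>S ! i\<close>.\<close>

definition next_letter :: "letter list \<Rightarrow> letter list \<Rightarrow> letter" where
  "next_letter S s = S ! overlap S s"

definition game_over :: "letter list \<Rightarrow> letter list \<Rightarrow> letter list \<Rightarrow> bool" where
  "game_over A B s \<longleftrightarrow> sublist A s \<or> sublist B s"

text \<open>\<open>game_output A B k\<close> is the sequence after \<open>k\<close> turns; it stays constant once the game is over.
  Alice makes the turns with even index \<open>k = 0, 2, \<dots>\<close>.\<close>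

primrec game_output :: "letter list \<Rightarrow> letter list \<Rightarrow> nat \<Rightarrow> letter list" where
  "game_output A B 0 = []"
| "game_output A B (Suc k) =
    (let s = game_output A B k in
     if game_over A B s then s
     else s @ [next_letter (if even k then A else B) s])"

definition alice_wins :: "letter list \<Rightarrow> letter list \<Rightarrow> bool" where
  "alice_wins A B \<longleftrightarrow>
    (\<exists>k. sublist A (game_output A B k) \<and> (\<forall>j\<le>k. \<not> sublist B (game_output A B j)))"

definition bob_wins :: "letter list \<Rightarrow> letter list \<Rightarrow> bool" where
  "bob_wins A B \<longleftrightarrow>
    (\<exists>k. sublist B (game_output A B k) \<and> (\<forall>j\<le>k. \<not> sublist A (game_output A B j)))"

definition infinite_game :: "letter list \<Rightarrow> letter list \<Rightarrow> bool" where
  "infinite_game A B \<longleftrightarrow> (\<forall>k. \<not> game_over A B (game_output A B k))"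

end

theory Submission
  imports Defs
begin

text \<open>Alice always plays \<open>H\<close>. If \<open>B\<close> has \<open>H\<close>s in all odd positions, Bob spells \<open>B\<close> from the start;
  if it has \<open>H\<close>s in all even positions, the output is \<open>H # B\<close>, unless Alice's string is completed
  first, which forces \<open>n\<close> odd and \<open>B = HH\<dots>HT\<close>. Otherwise \<open>B\<close> has \<open>T\<close>s at positions of both parities.
  Such a \<open>B\<close> never fits into an output whose odd positions are all \<open>H\<close>, and since \<open>B\<close> has two \<open>T\<close>s,
  Bob plays \<open>T\<close> as soon as the last \<open>n - 2\<close> letters are \<open>H\<close>, so \<open>A\<close> never appears either.\<close>

section \<open>Overlaps and the letter they determine\<close>

lemma overlap_props:
  assumes "S \<noteq> []"
  shows "overlap S s < length S" "suffix (take (overlap S s) S) s"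
proof -
  have "0 \<in> {i. i < length S \<and> suffix (take i S) s}" using assms by simp
  then have "overlap S s \<in> {i. i < length S \<and> suffix (take i S) s}"
    unfolding overlap_def by (intro Max_in) auto
  then show "overlap S s < length S" "suffix (take (overlap S s) S) s" by auto
qed

lemma overlap_ge:
  assumes "i < length S" "suffix (take i S) s"
  shows "i \<le> overlap S s"
  unfolding overlap_def using assms by (intro Max_ge) auto

lemma overlap_le_length:
  assumes "S \<noteq> []"
  shows "overlap S s \<le> length s"
  using overlap_props[OF assms, of s] suffix_length_le by fastforce

text \<open>No overlap exceeds the length of the output, so a player whose string has been spelled
  exactly so far simply continues it.\<close>

lemma overlap_take:
  assumes "k < length S"
  shows "overlap S (take k S) = k"
proof (rule antisym)
  have "S \<noteq> []" using assms by auto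
  from overlap_le_length[OF this, of "take k S"] show "overlap S (take k S) \<le> k" using assms by simp
  show "k \<le> overlap S (take k S)" using assms by (intro overlap_ge) auto
qed

lemma next_letter_replicate:
  assumes "n \<ge> 1"
  shows "next_letter (replicate n x) s = x"
  using overlap_props(1)[of "replicate n x" s] assms by (simp add: next_letter_def)

section \<open>Sublists, outcomes and predicted outputs\<close>

lemma sublist_same_length:
  assumes "sublist xs ys" "length ys \<le> length xs"
  shows "xs = ys"
proof -
  from assms(1) obtain ps ss where "ys = ps @ xs @ ss" by (auto simp: sublist_def)
  with assms(2) show ?thesis by simp
qed

lemma sublist_snoc_cases:
  assumes "sublist xs (ys @ [y])" "\<not> sublist xs ys"
  shows "suffix xs (ys @ [y])"
proof -
  from assms(1) obtain ps ss where eq: "ys @ [y] = ps @ xs @ ss" by (auto simp: sublist_def)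
  show ?thesis
  proof (cases ss rule: rev_cases)
    case Nil
    then show ?thesis using eq by (auto simp: suffix_def)
  next
    case (snoc zs z)
    then have "ys = ps @ xs @ zs" using eq by simp
    then show ?thesis using assms(2) by (auto simp: sublist_def)
  qed
qed

text \<open>At the earlier of the two witnessing turns, one claim asserts an occurrence that the
  other forbids. This exclusion later turns sufficient conditions into equivalences.\<close>

lemma not_alice_and_bob:
  assumes "alice_wins A B" "bob_wins A B"
  shows False
proof -
  from assms obtain k l where
    "sublist A (game_output A B k)" "\<forall>j\<le>k. \<not> sublist B (game_output A B j)"
    "sublist B (game_output A B l)" "\<forall>j\<le>l. \<not> sublist A (game_output A B j)"
    unfolding alice_wins_def bob_wins_def by blast
  then show False using nat_le_linear[of k l] by blast
qed

lemma infinite_game_no_winner: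
  assumes "infinite_game A B"
  shows "\<not> alice_wins A B" "\<not> bob_wins A B"
  using assms by (auto simp: infinite_game_def alice_wins_def bob_wins_def game_over_def)

text \<open>Allows the whole output \<open>w\<close> to be guessed in advance and checked one turn
  at a time.\<close>

lemma game_output_eq_take:
  assumes "k \<le> length w"
    and "\<And>j. j < k \<Longrightarrow> \<not> game_over A B (take j w)"
    and "\<And>j. j < k \<Longrightarrow> next_letter (if even j then A else B) (take j w) = w ! j"
  shows "game_output A B k = take k w"
  using assms
proof (induction k)
  case (Suc k)
  then have "game_output A B k = take k w" by simp
  with Suc.prems(2,3)[of k] Suc.prems(1) show ?case
    by (simp add: Let_def take_Suc_conv_app_nth)
qed simp

lemma not_game_over_short:
  assumes "length A = n" "length B = n" "length s < n"
  shows "\<not> game_over A B s"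
  using assms sublist_length_le[of A s] sublist_length_le[of B s] by (auto simp: game_over_def)

section \<open>Games that end\<close>

lemma alice_wins_if:
  assumes "odd n"
  shows "alice_wins (replicate n H) (replicate (n - 1) H @ [T])"
proof -
  let ?A = "replicate n H" and ?B = "replicate (n - 1) H @ [T]"
  have n: "n \<ge> 1" using assms by (cases n) auto
  have "next_letter (if even j then ?A else ?B) (take j ?A) = ?A ! j" if "j < n" for j
  proof (cases "even j")
    case True
    then show ?thesis using next_letter_replicate[OF n] that by simp
  next
    case False
    \<comment> \<open>As \<open>n\<close> is odd, the turn with index \<open>n - 1\<close> is
      Alice's, so Bob never reaches the final \<open>T\<close> of his string.\<close>
    then have j: "j < n - 1" using that assms by (cases "j = n - 1") auto
    then have "take j ?A = take j ?B" by simp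
    then show ?thesis using False j overlap_take[of j ?B] by (simp add: next_letter_def nth_append)
  qed
  then have out: "game_output ?A ?B k = take k ?A" if "k \<le> n" for k
    using that n by (intro game_output_eq_take not_game_over_short[of _ n]) auto
  have "\<not> sublist ?B (take k ?A)" for k
    using set_mono_sublist[of ?B "take k ?A"] by auto
  then have "\<forall>k\<le>n. \<not> sublist ?B (game_output ?A ?B k)" using out by metis
  then show ?thesis unfolding alice_wins_def using out[of n] by (intro exI[of _ n]) auto
qed

text \<open>Even indices, counted from \<open>0\<close>, are Alice's turns. Her \<open>H\<close>
  always agrees with \<open>B\<close>, so Bob's overlap stays the entire output.\<close>

lemma bob_wins_if_odd_H:
  assumes n: "n \<ge> 1" and B: "length B = n" "B \<noteq> replicate n H"
    and H: "\<And>i. i < n \<Longrightarrow> even i \<Longrightarrow> B ! i = H"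
  shows "bob_wins (replicate n H) B"
proof -
  let ?A = "replicate n H"
  have "next_letter (if even j then ?A else B) (take j B) = B ! j" if "j < n" for j
    using next_letter_replicate[OF n] overlap_take[of j B] that H B by (simp add: next_letter_def)
  then have out: "game_output ?A B k = take k B" if "k \<le> n" for k
    using that B by (intro game_output_eq_take not_game_over_short[of _ n]) auto
  have "\<not> sublist ?A (take k B)" for k
  proof
    assume "sublist ?A (take k B)"
    then have "sublist ?A B" by (meson sublist_order.order_trans sublist_take)
    then show False using sublist_same_length[of ?A B] B by simp
  qed
  then show ?thesis unfolding bob_wins_def using out B by (intro exI[of _ n]) auto
qed

text \<open>The equation says that every letter equals its predecessor, the first one being preceded
  by \<open>x\<close>.\<close>

lemma constant_if_shift:
  assumes "take k (x # xs) = take k xs" "i < k" "i < length xs"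
  shows "xs ! i = x"
  using assms(2,3)
proof (induction i)
  case 0
  then show ?case using arg_cong[OF assms(1), of "\<lambda>l. l ! 0"] by simp
next
  case (Suc i)
  then show ?case using arg_cong[OF assms(1), of "\<lambda>l. l ! Suc i"] by simp
qed

text \<open>Alice's opening \<open>H\<close> shifts \<open>B\<close> by one, so that her later turns
  fall on odd indices of \<open>B\<close>. The excluded case is the one in which \<open>A\<close> is
  a prefix of \<open>H # B\<close>.\<close>

lemma bob_wins_if_even_H:
  assumes n: "n \<ge> 1" and B: "length B = n" "B \<noteq> replicate n H"
    and exc: "\<not> (odd n \<and> B = replicate (n - 1) H @ [T])"
    and H: "\<And>i. i < n \<Longrightarrow> odd i \<Longrightarrow> B ! i = H"
  shows "bob_wins (replicate n H) B"
proof -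
  let ?A = "replicate n H"
  have B_ne: "B \<noteq> []" using n B by auto
  have noA: "take n (H # B) \<noteq> ?A"
  proof
    assume eq: "take n (H # B) = ?A"
    have pre: "B ! i = H" if "i < n - 1" for i
      using arg_cong[OF eq, of "\<lambda>l. l ! Suc i"] that by simp
    have T: "B ! (n - 1) = T"
    proof (rule ccontr)
      assume "B ! (n - 1) \<noteq> T"
      then have "B ! (n - 1) = H" by (cases "B ! (n - 1)") auto
      then have "B ! i = H" if "i < n" for i using pre[of i] that by (cases "i = n - 1") auto
      then show False using B by (auto simp: list_eq_iff_nth_eq)
    qed
    have "B = replicate (n - 1) H @ [T]"
    proof (rule nth_equalityI)
      fix i assume "i < length B"
      then show "B ! i = (replicate (n - 1) H @ [T]) ! i"
        using pre[of i] T B by (cases "i = n - 1") (auto simp: nth_append)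
    qed (use n B in simp)
    \<comment> \<open>For even \<open>n\<close> the final \<open>T\<close> would stand at an odd
      index, where \<open>B\<close> has \<open>H\<close>.\<close>
    moreover have "odd n" using T H[of "n - 1"] n by (cases "odd n") auto
    ultimately show False using exc by simp
  qed
  have noB: "take n (H # B) \<noteq> B"
    using constant_if_shift[of n H B] B by (auto simp: list_eq_iff_nth_eq)
  have no: "\<not> game_over ?A B (take j (H # B))" if "j \<le> n" for j
  proof (cases "j = n")
    case True
    then show ?thesis using noA noB sublist_same_length[of ?A "take n (H # B)"]
        sublist_same_length[of B "take n (H # B)"] B by (auto simp: game_over_def)
  next
    case False
    then show ?thesis using that B by (intro not_game_over_short[of _ n]) auto
  qed
  have "next_letter (if even j then ?A else B) (take j (H # B)) = (H # B) ! j" if "j < Suc n" for j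
  proof (cases "even j")
    case True
    then show ?thesis using next_letter_replicate[OF n] that H[of "j - 1"] by (cases j) auto
  next
    case False
    then obtain i where j: "j = Suc i" "even i" by (cases j) auto
    let ?s = "take j (H # B)"
    have s: "?s = H # take i B" using j by simp
    have "i \<le> overlap B ?s" using that j B by (intro overlap_ge) (auto simp: suffix_def)
    moreover have "overlap B ?s \<le> j" using overlap_le_length[OF B_ne, of ?s] by simp
    \<comment> \<open>Overlap \<open>i\<close> gives the intended letter. If instead the entire
      output matches, \<open>B\<close> begins with a run of \<open>H\<close>s through index
      \<open>i\<close>, and \<open>B ! j\<close> is \<open>H\<close> by parity, so the letter is the
      same.\<close>
    ultimately consider "overlap B ?s = i" | "overlap B ?s = j" using j by linarith
    then show ?thesis
    proof cases
      case 1
      then show ?thesis using j by (simp add: next_letter_def)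
    next
      case 2
      with overlap_props[OF B_ne, of ?s] have lt: "j < n" and suf: "suffix (take j B) ?s"
        using B by auto
      from suf obtain zs where zs: "?s = zs @ take j B" by (auto simp: suffix_def)
      moreover have "zs = []" using arg_cong[OF zs, of length] lt B by simp
      ultimately have "take j B = ?s" by simp
      then have "B ! i = H" using constant_if_shift[of j H B i] j lt B by simp
      moreover have "B ! j = H" using H lt j by simp
      ultimately show ?thesis using 2 j by (simp add: next_letter_def)
    qed
  qed
  then have out: "game_output ?A B k = take k (H # B)" if "k \<le> Suc n" for k
    using that B no by (intro game_output_eq_take) auto
  have "\<not> sublist ?A (take k (H # B))" if "k \<le> Suc n" for k
  proof (cases "k = Suc n")
    case True
    \<comment> \<open>In \<open>H # B\<close>, of length \<open>n + 1\<close>, the string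
      \<open>A\<close> can only be a prefix or \<open>B\<close> itself.\<close>
    have "take n (H # B) = ?A" if "prefix ?A (H # B)"
      using that by (auto simp: prefix_def)
    then show ?thesis using True B noA sublist_same_length[of ?A B] by (auto simp: sublist_Cons_right)
  next
    case False
    then show ?thesis using that no[of k] by (auto simp: game_over_def)
  qed
  then have "\<forall>k\<le>Suc n. \<not> sublist ?A (game_output ?A B k)" using out by metis
  moreover have "sublist B (game_output ?A B (Suc n))"
    using out[of "Suc n"] B by (simp add: sublist_Cons_right del: game_output.simps)
  ultimately show ?thesis unfolding bob_wins_def by blast
qed

section \<open>Infinite games\<close>

lemma next_letter_T_after_run:
  assumes pq: "p < q" "q < length B" "B ! p = T" "B ! q = T"
    and run: "suffix (replicate (length B - 2) H) s"
  shows "next_letter B s = T"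
proof -
  define n where "n = length B"
  define i where "i = overlap B s"
  have "B \<noteq> []" using pq by auto
  from overlap_props[OF this, of s] have i: "i < n" "suffix (take i B) s"
    by (simp_all add: n_def i_def)
  show ?thesis
  proof (cases "i = n - 1")
    case True
    \<comment> \<open>The prefix of length \<open>n - 1\<close> ends in the run, so \<open>T\<close>
      can only stand at the two ends of \<open>B\<close>. Hence \<open>q\<close> is the last index,
      and its \<open>T\<close> is what Bob appends.\<close>
    have "B ! j = H" if "1 \<le> j" "j < n - 1" for j
    proof -
      have "suffix (replicate (n - 2) H) (take (n - 1) B)"
        by (rule suffix_length_suffix[of _ s]) (use i run True in \<open>simp_all add: n_def\<close>)
      then obtain ps where ps: "take (n - 1) B = ps @ replicate (n - 2) H" by (auto simp: suffix_def)
      have "n - 1 = length ps + (n - 2)" using arg_cong[OF ps, of length] by (simp add: n_def)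
      then have "length ps = 1" using that by linarith
      then show ?thesis using arg_cong[OF ps, of "\<lambda>l. l ! j"] that by (simp add: nth_append)
    qed
    from this[of q] have "q = n - 1" using pq by (cases "q < n - 1") (auto simp: n_def)
    then show ?thesis using True pq by (simp add: next_letter_def i_def)
  next
    case False
    \<comment> \<open>A smaller overlap lies inside the run and cannot reach past the first
      \<open>T\<close>, at index \<open>m\<close>. As \<open>m \<le> p \<le> n - 2\<close>, all the
      \<open>H\<close>s before it fit into the run, so the overlap is exactly
      \<open>m\<close>.\<close>
    define m where "m = (LEAST j. B ! j = T)"
    have m: "B ! m = T" "m \<le> p"
      unfolding m_def using LeastI[of "\<lambda>j. B ! j = T" p] Least_le[of "\<lambda>j. B ! j = T" p] pq by blast+
    have below: "B ! j = H" if "j < m" for j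
      using not_less_Least[of j "\<lambda>j. B ! j = T"] that unfolding m_def by (cases "B ! j") auto
    have "take m B = replicate m H" using m pq below by (auto simp: list_eq_iff_nth_eq)
    moreover have "suffix (replicate m H) (replicate (n - 2) H)"
      unfolding suffix_def using m pq
      by (intro exI[of _ "replicate (n - 2 - m) H"]) (simp add: n_def flip: replicate_add)
    ultimately have "suffix (take m B) s" using run by (metis n_def suffix_order.order_trans)
    then have "m \<le> i" unfolding i_def using m pq by (intro overlap_ge) auto
    moreover have "i \<le> m"
    proof -
      have "suffix (take i B) (replicate (n - 2) H)"
        by (rule suffix_length_suffix[of _ s]) (use i run False in \<open>simp_all add: n_def\<close>)
      then have "set (take i B) \<subseteq> {H}" using set_mono_suffix by fastforce
      then have "B ! j = H" if "j < i" for j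
        using that i nth_mem[of j "take i B"] by (auto simp: n_def)
      then show ?thesis using m by (metis letter.distinct(1) not_le)
    qed
    ultimately show ?thesis using m by (simp add: next_letter_def i_def)
  qed
qed

lemma infinite_game_if:
  assumes B: "length B = n"
    and p: "p < n" "even p" "B ! p = T" and q: "q < n" "odd q" "B ! q = T"
  shows "infinite_game (replicate n H) B"
proof -
  let ?A = "replicate n H"
  let ?out = "game_output ?A B"
  have "p \<noteq> q" using p q by auto
  then have n2: "n \<ge> 2" using p q by auto
  have bob: "next_letter B s = T" if "suffix (replicate (n - 2) H) s" for s
    using next_letter_T_after_run[of p q B s] next_letter_T_after_run[of q p B s]
      p q B that \<open>p \<noteq> q\<close> by (cases "p < q") auto
  have noB: "\<not> sublist B s" if "\<And>i. i < length s \<Longrightarrow> even i \<Longrightarrow> s ! i = H" for s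
  proof
    assume "sublist B s"
    then obtain ps ss where s: "s = ps @ B @ ss" by (auto simp: sublist_def)
    \<comment> \<open>Whatever the parity of the offset, one of the two \<open>T\<close>s of
      \<open>B\<close> lands on a turn of Alice.\<close>
    define r where "r = (if even (length ps) then p else q)"
    have r: "r < n" "even (length ps + r)" "B ! r = T" using p q by (auto simp: r_def)
    have "s ! (length ps + r) = T" using r B s by (simp add: nth_append)
    moreover have "s ! (length ps + r) = H" using that[OF _ r(2)] r(1) B s by simp
    ultimately show False by simp
  qed
  have "\<not> game_over ?A B (?out k) \<and> length (?out k) = k \<and> (\<forall>i<k. even i \<longrightarrow> ?out k ! i = H)" for k
  \<comment> \<open>Strong induction, because ruling out a completion of \<open>A\<close> by Alice
    looks back to Bob's preceding turn.\<close>
  proof (induction k rule: less_induct)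
    case (less k)
    show ?case
    proof (cases k)
      case 0
      have "\<not> game_over ?A B []" using B n2 by (intro not_game_over_short[of _ n]) auto
      then show ?thesis using 0 by simp
    next
      case (Suc l)
      let ?x = "next_letter (if even l then ?A else B) (?out l)"
      have IH: "\<not> game_over ?A B (?out l)" "length (?out l) = l"
        "\<And>i. i < l \<Longrightarrow> even i \<Longrightarrow> ?out l ! i = H" using less[of l] Suc by auto
      have out: "?out k = ?out l @ [?x]" using IH(1) Suc by (simp add: Let_def)
      have len: "length (?out k) = k" using out IH(2) Suc by simp
      have H: "?out k ! i = H" if "i < k" "even i" for i
        unfolding out using that IH(2,3) Suc n2 next_letter_replicate[of n]
        by (auto simp: nth_append less_Suc_eq)
      have "\<not> sublist ?A (?out k)"
      proof
        assume "sublist ?A (?out k)"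
        then have "suffix ?A (?out l @ [?x])"
          using sublist_snoc_cases[of ?A "?out l" ?x] IH(1) unfolding out game_over_def by blast
        then have "suffix (replicate (n - 1) H @ [H]) (?out l @ [?x])"
          using n2 by (cases n) (auto simp: replicate_append_same)
        then have x: "?x = H" and suf: "suffix (replicate (n - 1) H) (?out l)" by auto
        have split: "replicate (n - 1) H = replicate (n - 2) H @ [H]"
          "replicate (n - 1) H = H # replicate (n - 2) H"
          using n2 by (auto simp: replicate_append_same numeral_2_eq_2 Suc_diff_Suc
              simp flip: replicate_Suc)
        show False
        proof (cases "even l")
          case False
          have "suffix (replicate (n - 2) H) (?out l)"
            using suf unfolding split(2) by (rule suffix_ConsD)
          then show False using bob x False by simp
        next
          case True
          \<comment> \<open>Alice would complete \<open>A\<close> here, so Bob has just appended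
            \<open>H\<close> after \<open>n - 2\<close> letters \<open>H\<close>. This is why the
            run in \<open>bob\<close> has length \<open>n - 2\<close> and not
            \<open>n - 1\<close>.\<close>
          have "l \<noteq> 0" using suf n2 by (cases "l = 0") auto
          then obtain j where j: "l = Suc j" by (cases l) auto
          have "\<not> game_over ?A B (?out j)" using less[of j] j Suc by simp
          then have "?out l = ?out j @ [next_letter B (?out j)]" using j True by (simp add: Let_def)
          with suf have "next_letter B (?out j) = H" "suffix (replicate (n - 2) H) (?out j)"
            unfolding split(1) by auto
          then show False using bob by simp
        qed
      qed
      moreover have "\<not> sublist B (?out k)" using noB[of "?out k"] H len by simp
      ultimately show ?thesis using len H by (simp add: game_over_def)
    qed
  qed
  then show ?thesis by (simp add: infinite_game_def)
qed

theorem lemma19: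
  fixes n :: nat and A B :: "letter list"
  assumes "n \<ge> 1"
    and "A = replicate n H"
    and "length B = n"
    and "B \<noteq> A"
  shows
    "(alice_wins A B \<longleftrightarrow> odd n \<and> B = replicate (n - 1) H @ [T])
     \<and> (\<not> (odd n \<and> B = replicate (n - 1) H @ [T]) \<longrightarrow>
          (bob_wins A B \<longleftrightarrow>
             (\<forall>i\<in>{1..n}. odd i \<longrightarrow> B ! (i - 1) = H)
             \<or> (\<forall>i\<in>{1..n}. even i \<longrightarrow> B ! (i - 1) = H)))
     \<and> (\<not> (odd n \<and> B = replicate (n - 1) H @ [T])
          \<and> \<not> ((\<forall>i\<in>{1..n}. odd i \<longrightarrow> B ! (i - 1) = H)
               \<or> (\<forall>i\<in>{1..n}. even i \<longrightarrow> B ! (i - 1) = H))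
          \<longrightarrow> infinite_game A B)"
proof -
  let ?E = "odd n \<and> B = replicate (n - 1) H @ [T]"
  let ?O = "\<forall>i\<in>{1..n}. odd i \<longrightarrow> B ! (i - 1) = H"
  let ?V = "\<forall>i\<in>{1..n}. even i \<longrightarrow> B ! (i - 1) = H"
  have neq: "x = T" if "x \<noteq> H" for x using that by (cases x) auto
  have alice: "alice_wins A B" if ?E using alice_wins_if[of n] that assms(2) by simp
  have odd: "bob_wins A B" if ?O
  proof -
    \<comment> \<open>Positions in the theorem start at \<open>1\<close>, so odd positions are even
      list indices.\<close>
    have "B ! i = H" if "i < n" "even i" for i
      using bspec[OF \<open>?O\<close>, of "Suc i"] that by simp
    then show ?thesis using bob_wins_if_odd_H[of n B] assms by simp
  qed
  have even: "bob_wins A B" if ?V "\<not> ?E"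
  proof -
    have "B ! i = H" if "i < n" "odd i" for i
      using bspec[OF \<open>?V\<close>, of "Suc i"] that by simp
    then show ?thesis using bob_wins_if_even_H[of n B] assms that by simp
  qed
  have inf: "infinite_game A B" if "\<not> ?O" "\<not> ?V"
  proof -
    from \<open>\<not> ?O\<close> obtain i where i: "1 \<le> i" "i \<le> n" "odd i" "B ! (i - 1) = T" using neq by auto
    from \<open>\<not> ?V\<close> obtain j where j: "1 \<le> j" "j \<le> n" "even j" "B ! (j - 1) = T" using neq by auto
    show ?thesis using infinite_game_if[of B n "i - 1" "j - 1"] i j assms by auto
  qed
  show ?thesis
    using alice odd even inf not_alice_and_bob[of A B] infinite_game_no_winner[of A B] by argo
qed

end
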